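(* Let $p\ge1$ be an integer. If the input is GI/GI, i.e. $(\tau\circ\theta^n)_{n\in\mathbb Z}$ and $(\sigma\circ\theta^n)_{n\in\mathbb Z}$ are two mutually independent i.i.d. sequences, if the distribution of $\tau$ has unbounded support, and if $\mathbb P[Z_p=0]>0$, then the equation $$U\circ\theta=H^p(U)\quad \mathbb P\text{-a.s.}$$ admits a unique (up to a.s. equality) finite $\overline{(\mathbb R_+)^p}$-valued solution $U^p$ defined on $\Omega$, and it satisfies $$U^p\prec (Z_p,Z_{p-1},\dots,Z_1)\quad\text{a.s.}$$
   Context: Setting: $(\Omega,\mathcal F,\mathbb P)$ is a probability space and $\theta$ is a bijective bimeasurable map of $\Omega$ that preserves $\mathbb P$ and is ergodic. $\sigma,\tau$ are non-negative integrable random variables on $\Omega$ with $\mathbb P[\tau>0]=1$. Notation: $x^+=\max(x,0)$, applied coordinatewise to vectors. For $u\in\mathbb R^q$, $\bar u$ denotes the vector $u$ with coordinates rearranged in nondecreasing order; $\overline{(\mathbb R_+)^q}$ is the set of vectors of $(\mathbb R_+)^q$ with nondecreasing coordinates. $u\prec v$ means $u(i)\le v(i)$ for all $i$. $\mathbf e_1=(1,0,\dots,0)$, $\mathbf 1=(1,\dots,1)$. For $\ell\ge1$, $Z_\ell=\Big[\sup_{k\ge \ell}\Big(\sigma\circ\theta^{-k}-\sum_{i=1}^k\tau\circ\theta^{-i}\Big)\Big]^+$. The random map $H^p:\overline{(\mathbb R_+)^p}\to\overline{(\mathbb R_+)^p}$ (driving the ordered workload vector of a pure loss system with $p$ servers)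 is $$H^p(u)=\overline{\big[u+\sigma\mathbf 1_{\{u(1)=0\}}\mathbf e_1-\tau\mathbf 1\big]^+}.$$ *)

theory Defs
  imports "HOL-Probability.Probability"
begin

locale ergodic_automorphism = prob_space M for M :: "'a measure" +
  fixes \<theta> :: "'a \<Rightarrow> 'a"
  assumes bij: "bij_betw \<theta> (space M) (space M)"
    and measurable_theta: "\<theta> \<in> measurable M M"
    and measurable_inverse: "inv_into (space M) \<theta> \<in> measurable M M"
    and preserving: "distr M M \<theta> = M"
    and ergodic: "\<And>A. A \<in> sets M \<Longrightarrow> \<theta> -` A \<inter> space M = A \<Longrightarrow> prob A = 0 \<or> prob A = 1"

text \<open>\<open>shift M \<theta> n\<close> is the iterate \<open>\<theta>\<^sup>n\<close> for an arbitrary integer \<open>n\<close>.\<close>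

definition shift :: "'a measure \<Rightarrow> ('a \<Rightarrow> 'a) \<Rightarrow> int \<Rightarrow> 'a \<Rightarrow> 'a" where
  "shift M \<theta> n =
     (if n \<ge> 0 then \<theta> ^^ nat n else inv_into (space M) \<theta> ^^ nat (- n))"

definition iid :: "'a measure \<Rightarrow> (int \<Rightarrow> 'a \<Rightarrow> real) \<Rightarrow> bool" where
  "iid M X \<longleftrightarrow>
     prob_space.indep_vars M (\<lambda>_. borel) X UNIV \<and>
     (\<forall>m n. distr M borel (X m) = distr M borel (X n))"

definition GI_GI ::
  "'a measure \<Rightarrow> ('a \<Rightarrow> 'a) \<Rightarrow> ('a \<Rightarrow> real) \<Rightarrow> ('a \<Rightarrow> real) \<Rightarrow> bool" where
  "GI_GI M \<theta> \<sigma> \<tau> \<longleftrightarrow>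
     iid M (\<lambda>n. \<tau> \<circ> shift M \<theta> n) \<and>
     iid M (\<lambda>n. \<sigma> \<circ> shift M \<theta> n) \<and>
     prob_space.indep_var M
       (PiM UNIV (\<lambda>_::int. borel)) (\<lambda>\<omega> n. \<tau> (shift M \<theta> n \<omega>))
       (PiM UNIV (\<lambda>_::int. borel)) (\<lambda>\<omega> n. \<sigma> (shift M \<theta> n \<omega>))"

definition topological_support :: "'b::topological_space measure \<Rightarrow> 'b set" where
  "topological_support \<mu> = {x. \<forall>S. open S \<and> x \<in> S \<longrightarrow> emeasure \<mu> S > 0}"

text \<open>The supremum is taken in the extended reals, where it exists without any
  assumption; \<open>SUP\<close> on \<open>real\<close> would be meaningless on unbounded sets.\<close>

definition Z ::
  "'a measure \<Rightarrow> ('a \<Rightarrow> 'a) \<Rightarrow> ('a \<Rightarrow> real) \<Rightarrow> ('a \<Rightarrow> real) \<Rightarrow> nat \<Rightarrow> 'a \<Rightarrow> ereal" where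
  "Z M \<theta> \<sigma> \<tau> l \<omega> =
     max (SUP k\<in>{l..}. ereal (\<sigma> (shift M \<theta> (- int k) \<omega>)
                               - (\<Sum>i=1..k. \<tau> (shift M \<theta> (- int i) \<omega>)))) 0"

text \<open>Vectors of \<open>\<real>\<^sup>p\<close> are lists of length \<open>p\<close>, indexed from \<open>0\<close>: the coordinate
  \<open>u(i)\<close> is \<open>u ! (i - 1)\<close>, and \<open>sort\<close> is the nondecreasing rearrangement.\<close>

definition ordered_nonneg :: "nat \<Rightarrow> real list set" where
  "ordered_nonneg p = {u. length u = p \<and> sorted u \<and> (\<forall>x\<in>set u. 0 \<le> x)}"

text \<open>\<open>loss_map s t\<close> is the map \<open>H\<^sup>p\<close> for the realised values \<open>s\<close> of \<open>\<sigma>\<close> and \<open>t\<close> of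
  \<open>\<tau>\<close>; the dimension \<open>p\<close> is the length of the argument.\<close>

definition loss_map :: "real \<Rightarrow> real \<Rightarrow> real list \<Rightarrow> real list" where
  "loss_map s t u =
     sort (map (\<lambda>i. max (u ! i + (if i = 0 \<and> u ! 0 = 0 then s else 0) - t) 0)
               [0..<length u])"

lemma loss_map_ordered_nonneg:
  "u \<in> ordered_nonneg p \<Longrightarrow> loss_map s t u \<in> ordered_nonneg p"
  by (auto simp: loss_map_def ordered_nonneg_def)

definition ordered_random_vector :: "'a measure \<Rightarrow> nat \<Rightarrow> ('a \<Rightarrow> real list) \<Rightarrow> bool" where
  "ordered_random_vector M p U \<longleftrightarrow>
     (\<forall>\<omega>\<in>space M. U \<omega> \<in> ordered_nonneg p) \<and>
     (\<forall>i<p. (\<lambda>\<omega>. U \<omega> ! i) \<in> borel_measurable M)"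

definition loss_solution ::
  "'a measure \<Rightarrow> ('a \<Rightarrow> 'a) \<Rightarrow> ('a \<Rightarrow> real) \<Rightarrow> ('a \<Rightarrow> real) \<Rightarrow> nat \<Rightarrow> ('a \<Rightarrow> real list) \<Rightarrow> bool" where
  "loss_solution M \<theta> \<sigma> \<tau> p U \<longleftrightarrow>
     ordered_random_vector M p U \<and>
     (AE \<omega> in M. U (\<theta> \<omega>) = loss_map (\<sigma> \<omega>) (\<tau> \<omega>) (U \<omega>))"

context ergodic_automorphism
begin

lemma measurable_shift [measurable]: "shift M \<theta> n \<in> measurable M M"
proof -
  have "f ^^ k \<in> measurable M M" if "f \<in> measurable M M" for f :: "'a \<Rightarrow> 'a" and k
    using that by (induction k) (auto intro: measurable_comp)
  then show ?thesis
    using measurable_theta measurable_inverse by (simp add: shift_def)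
qed

lemma measurable_Z:
  assumes [measurable]: "\<sigma> \<in> borel_measurable M" "\<tau> \<in> borel_measurable M"
  shows "Z M \<theta> \<sigma> \<tau> l \<in> borel_measurable M"
  unfolding Z_def by measurable

end

end

theory Submission
  imports Defs
begin

text \<open>Each positive coordinate of a stationary workload is the residual service of a customer,
  and distinct coordinates belong to customers of distinct ages; so the \<open>l\<close>-th largest one is at
  most \<open>Z\<^sub>l\<close>. In particular every solution is empty on the event \<open>Z\<^sub>1 = 0\<close>. This event has
  positive probability: if \<open>Z\<^sub>p\<close> vanishes then \<open>Z\<^sub>1\<close> is finite, and the interarrival time that
  is subtracted last is unbounded and independent of the past. By ergodicity almost every
  trajectory has visited the event in the past, and the recursion started empty at such a visit
  does not depend on the visit chosen. Its value at time \<open>0\<close> is the unique solution.\<close>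

section \<open>Order statistics and one step of the loss map\<close>

text \<open>Sorting preserves the number of entries that are at most \<open>c\<close>, and in the
  sorted list these entries form an initial segment.\<close>

lemma sort_nth_le_iff:
  fixes xs :: "'b::linorder list"
  assumes "i < length xs"
  shows "sort xs ! i \<le> c \<longleftrightarrow> i < card {j. j < length xs \<and> xs ! j \<le> c}"
proof -
  define ys where "ys = sort xs"
  have ys: "sorted ys" "length ys = length xs"
    by (simp_all add: ys_def)
  have "length (filter (\<lambda>x. x \<le> c) ys) = length (filter (\<lambda>x. x \<le> c) xs)"
    by (simp add: ys_def filter_sort)
  then have eq: "card {j. j < length xs \<and> xs ! j \<le> c} = card {j. j < length ys \<and> ys ! j \<le> c}"
    by (simp add: length_filter_conv_card)
  show ?thesis
  proof (cases "ys ! i \<le> c")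
    case True
    have "{..i} \<subseteq> {j. j < length ys \<and> ys ! j \<le> c}"
      using True ys assms by (auto intro: order_trans[OF sorted_nth_mono])
    then have "card {..i} \<le> card {j. j < length ys \<and> ys ! j \<le> c}"
      by (intro card_mono) auto
    then show ?thesis
      using True eq by (simp add: ys_def)
  next
    case False
    have "j < i" if "j < length ys" "ys ! j \<le> c" for j
    proof (rule ccontr)
      assume "\<not> j < i"
      then have "ys ! i \<le> ys ! j"
        using ys that by (intro sorted_nth_mono) auto
      then show False
        using False that by auto
    qed
    then have "{j. j < length ys \<and> ys ! j \<le> c} \<subseteq> {..<i}"
      by auto
    then have "card {j. j < length ys \<and> ys ! j \<le> c} \<le> card {..<i}"
      by (intro card_mono) auto
    then show ?thesis
      using False eq by (simp add: ys_def)
  qed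
qed

text \<open>To bound the order statistic of index \<open>i\<close> it is enough to inspect any
  \<open>i + 1\<close> positions: at least \<open>card J\<close> entries are at most the maximum
  over \<open>J\<close>.\<close>

lemma sort_nth_le_some:
  fixes xs :: "'b::linorder list"
  assumes "J \<subseteq> {..<length xs}" "i < card J"
  obtains j where "j \<in> J" "sort xs ! i \<le> xs ! j"
proof -
  have fin: "finite J"
    using assms(1) finite_subset by blast
  have ne: "J \<noteq> {}"
    using assms by auto
  have "i < length xs"
    using assms card_mono[OF _ assms(1)] by simp
  have "card J \<le> card {j. j < length xs \<and> xs ! j \<le> Max ((!) xs ` J)}"
    using assms(1) fin by (intro card_mono) auto
  then have "sort xs ! i \<le> Max ((!) xs ` J)"
    using assms(2) sort_nth_le_iff[OF \<open>i < length xs\<close>] by auto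
  moreover have "Max ((!) xs ` J) \<in> (!) xs ` J"
    using fin ne by (intro Max_in) auto
  ultimately show thesis
    using that by auto
qed

text \<open>\<open>b l\<close> and \<open>b' l\<close> bound the \<open>l\<close>-th largest coordinate before and after the step. If
  an empty server takes the new customer, the index of every other coordinate moves up by one,
  which \<open>step\<close> absorbs.\<close>

lemma loss_map_le_bound:
  fixes b b' :: "nat \<Rightarrow> ereal"
  assumes u: "u \<in> ordered_nonneg p"
    and bnd: "\<And>i. i < p \<Longrightarrow> ereal (u ! i) \<le> b (p - i)"
    and nonneg: "\<And>l. 1 \<le> l \<Longrightarrow> 0 \<le> b' l"
    and anti: "\<And>l. 1 \<le> l \<Longrightarrow> b' (Suc l) \<le> b' l"
    and step: "\<And>l. 1 \<le> l \<Longrightarrow> b l - ereal t \<le> b' (Suc l)"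
    and new: "ereal (s - t) \<le> b' 1"
    and i: "i < p"
  shows "ereal (loss_map s t u ! i) \<le> b' (p - i)"
proof -
  have len: "length u = p" and sorted: "sorted u"
    using u by (auto simp: ordered_nonneg_def)
  define xs where "xs = map (\<lambda>i. max (u ! i + (if i = 0 \<and> u ! 0 = 0 then s else 0) - t) 0) [0..<length u]"
  have lenx: "length xs = p"
    by (simp add: xs_def len)
  have loss: "loss_map s t u = sort xs"
    by (simp add: loss_map_def xs_def)
  have old: "ereal (u ! j - t) \<le> b' (Suc (p - j))" if "j < p" for j
  proof -
    have "ereal (u ! j - t) \<le> b (p - j) - ereal t"
      using ereal_minus_mono[OF bnd[OF that], of "ereal t" "ereal t"] by simp
    also have "\<dots> \<le> b' (Suc (p - j))"
      using that by (intro step) auto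
    finally show ?thesis .
  qed
  show ?thesis
  proof (cases "u ! 0 = 0 \<and> i + 1 < p")
    case True
    \<comment> \<open>The new customer sits at position \<open>0\<close>, so the
      \<open>i + 1\<close> positions from \<open>1\<close> to \<open>i + 1\<close> hold only old
      work. The bound before the step has index \<open>p - (i + 1)\<close>, and \<open>step\<close>
      raises it to \<open>p - i\<close>.\<close>
    obtain j where j: "j \<in> {1..i+1}" "sort xs ! i \<le> xs ! j"
      by (rule sort_nth_le_some[of "{1..i+1}" xs i]) (use True lenx in auto)
    have "u ! j \<le> u ! (i + 1)"
      using j True len sorted by (intro sorted_nth_mono) auto
    then have "ereal (u ! j - t) \<le> ereal (u ! (i + 1) - t)"
      by simp
    also have "\<dots> \<le> b' (p - i)"
      using old[of "i + 1"] True by (simp add: Suc_diff_Suc)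
    finally have "ereal (xs ! j) \<le> b' (p - i)"
      using j True len nonneg[of "p - i"] by (auto simp: xs_def max_def zero_ereal_def)
    then show ?thesis
      using j(2) loss by (metis ereal_less_eq(3) order_trans)
  next
    case False
    \<comment> \<open>Here either no server is empty or \<open>i\<close> is the last index. For old
      work \<open>step\<close> gives the index \<open>p - i + 1\<close>, which \<open>anti\<close>
      weakens to \<open>p - i\<close>.\<close>
    obtain j where j: "j \<in> {..i}" "sort xs ! i \<le> xs ! j"
      by (rule sort_nth_le_some[of "{..i}" xs i]) (use i lenx in auto)
    have "u ! j \<le> u ! i"
      using j i len sorted by (intro sorted_nth_mono) auto
    then have "ereal (u ! j - t) \<le> ereal (u ! i - t)"
      by simp
    also have "\<dots> \<le> b' (Suc (p - i))"
      using i by (rule old)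
    also have "\<dots> \<le> b' (p - i)"
      using i by (intro anti) auto
    finally have *: "ereal (u ! j - t) \<le> b' (p - i)" .
    have "ereal (xs ! j) \<le> b' (p - i)"
    proof (cases "j = 0 \<and> u ! 0 = 0")
      \<comment> \<open>Position \<open>0\<close> holds the arriving customer. Only the last index
        is left, where \<open>p - i = 1\<close> and \<open>new\<close> applies.\<close>
      case True
      then have "p - i = 1"
        using False i by auto
      then show ?thesis
        using True new nonneg[of 1] i len by (auto simp: xs_def max_def zero_ereal_def)
    next
      case False
      then show ?thesis
        using * j i len nonneg[of "p - i"] by (auto simp: xs_def max_def zero_ereal_def)
    qed
    then show ?thesis
      using j(2) loss by (metis ereal_less_eq(3) order_trans)
  qed
qed

text \<open>The event that the order statistic of index \<open>i\<close> is at most \<open>c\<close>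
  is a finite union, over index sets \<open>J\<close> with more than \<open>i\<close> elements, of
  finite intersections of coordinate events.\<close>

lemma measurable_loss_map_nth:
  assumes [measurable]: "s \<in> borel_measurable M" "t \<in> borel_measurable M"
    and u [measurable]: "\<And>j. j < p \<Longrightarrow> (\<lambda>\<omega>. u \<omega> ! j) \<in> borel_measurable M"
    and len: "\<And>\<omega>. \<omega> \<in> space M \<Longrightarrow> length (u \<omega>) = p"
    and i: "i < p"
  shows "(\<lambda>\<omega>. loss_map (s \<omega>) (t \<omega>) (u \<omega>) ! i) \<in> borel_measurable M"
proof (rule borel_measurable_iff_le[THEN iffD2], rule allI)
  fix c :: real
  define x where "x j \<omega> = max (u \<omega> ! j + (if j = 0 \<and> u \<omega> ! 0 = 0 then s \<omega> else 0) - t \<omega>) 0" for j \<omega>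
  have [measurable]: "(\<lambda>\<omega>. u \<omega> ! 0) \<in> borel_measurable M"
    using i by (intro u) auto
  have x [measurable]: "x j \<in> borel_measurable M" if "j < p" for j
    unfolding x_def using u[OF that] by measurable
  have "loss_map (s \<omega>) (t \<omega>) (u \<omega>) ! i \<le> c \<longleftrightarrow>
      (\<exists>J\<in>{J. J \<subseteq> {..<p} \<and> i < card J}. \<forall>j\<in>J. x j \<omega> \<le> c)" if "\<omega> \<in> space M" for \<omega>
  proof -
    define xs where "xs = map (\<lambda>j. x j \<omega>) [0..<p]"
    have "loss_map (s \<omega>) (t \<omega>) (u \<omega>) = sort xs"
      by (simp add: loss_map_def xs_def x_def len[OF that])
    moreover have "{j. j < length xs \<and> xs ! j \<le> c} = {j. j < p \<and> x j \<omega> \<le> c}"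
      by (auto simp: xs_def)
    ultimately have "loss_map (s \<omega>) (t \<omega>) (u \<omega>) ! i \<le> c \<longleftrightarrow> i < card {j. j < p \<and> x j \<omega> \<le> c}"
      using i by (simp add: sort_nth_le_iff xs_def)
    also have "\<dots> \<longleftrightarrow> (\<exists>J\<in>{J. J \<subseteq> {..<p} \<and> i < card J}. \<forall>j\<in>J. x j \<omega> \<le> c)"
    proof
      assume "i < card {j. j < p \<and> x j \<omega> \<le> c}"
      then show "\<exists>J\<in>{J. J \<subseteq> {..<p} \<and> i < card J}. \<forall>j\<in>J. x j \<omega> \<le> c"
        by (intro bexI[of _ "{j. j < p \<and> x j \<omega> \<le> c}"]) auto
    next
      assume "\<exists>J\<in>{J. J \<subseteq> {..<p} \<and> i < card J}. \<forall>j\<in>J. x j \<omega> \<le> c"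
      then obtain J where J: "J \<subseteq> {..<p}" "i < card J" "\<forall>j\<in>J. x j \<omega> \<le> c"
        by auto
      have "card J \<le> card {j. j < p \<and> x j \<omega> \<le> c}"
        using J by (intro card_mono) auto
      then show "i < card {j. j < p \<and> x j \<omega> \<le> c}"
        using J by simp
    qed
    finally show ?thesis .
  qed
  then have "{\<omega> \<in> space M. loss_map (s \<omega>) (t \<omega>) (u \<omega>) ! i \<le> c} =
      (\<Union>J\<in>{J. J \<subseteq> {..<p} \<and> i < card J}. {\<omega> \<in> space M. \<forall>j\<in>J. x j \<omega> \<le> c})"
    by auto
  moreover have "{\<omega> \<in> space M. \<forall>j\<in>J. x j \<omega> \<le> c} \<in> sets M" if "J \<subseteq> {..<p}" for J
  proof (intro sets.sets_Collect_finite_All)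
    show "finite J"
      using that finite_subset by blast
    show "{\<omega> \<in> space M. x j \<omega> \<le> c} \<in> sets M" if "j \<in> J" for j
    proof -
      have [measurable]: "x j \<in> borel_measurable M"
        using x \<open>J \<subseteq> {..<p}\<close> that by auto
      show ?thesis
        by measurable
    qed
  qed
  moreover have "finite {J. J \<subseteq> {..<p} \<and> i < card J}"
    by (rule finite_subset[of _ "Pow {..<p}"]) auto
  ultimately show "{\<omega> \<in> space M. loss_map (s \<omega>) (t \<omega>) (u \<omega>) ! i \<le> c} \<in> sets M"
    by (auto intro!: sets.finite_UN)
qed

section \<open>Independence and unbounded support\<close>

text \<open>With \<open>W\<close> frozen at \<open>w\<close>, the independence of
  \<open>f \<circ> T\<close> and \<open>h \<circ> T\<close> splits the probability, and the first
  factor does not depend on \<open>w\<close>; integration over the law of \<open>W\<close> gives the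
  product. This will make the current interarrival time independent of the past ones and the
  services jointly.\<close>

lemma (in prob_space) indep_var_prob_triple:
  assumes TW: "indep_var S T R W"
    and f [measurable]: "f \<in> measurable S N" and h [measurable]: "h \<in> measurable S N'"
    and fh: "indep_var N (f \<circ> T) N' (h \<circ> T)"
    and A [measurable]: "A \<in> sets N" and B [measurable]: "B \<in> sets (N' \<Otimes>\<^sub>M R)"
  shows "prob {\<omega> \<in> space M. f (T \<omega>) \<in> A \<and> (h (T \<omega>), W \<omega>) \<in> B} =
    prob {\<omega> \<in> space M. f (T \<omega>) \<in> A} * prob {\<omega> \<in> space M. (h (T \<omega>), W \<omega>) \<in> B}"
proof -
  have T [measurable]: "T \<in> measurable M S" and W [measurable]: "W \<in> measurable M R"
    using indep_var_rv1[OF TW] indep_var_rv2[OF TW] .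
  interpret T: prob_space "distr M S T" by (rule prob_space_distr) simp
  interpret W: prob_space "distr M R W" by (rule prob_space_distr) simp
  interpret P: pair_prob_space "distr M S T" "distr M R W" ..
  have D: "distr M (S \<Otimes>\<^sub>M R) (\<lambda>\<omega>. (T \<omega>, W \<omega>)) = distr M S T \<Otimes>\<^sub>M distr M R W"
    using TW by (simp add: indep_var_distribution_eq)
  have fubini: "emeasure M {\<omega> \<in> space M. (T \<omega>, W \<omega>) \<in> C} =
      (\<integral>\<^sup>+ w. emeasure M {\<omega> \<in> space M. (T \<omega>, w) \<in> C} \<partial>distr M R W)"
    if C [measurable]: "C \<in> sets (S \<Otimes>\<^sub>M R)" for C
  proof -
    have "emeasure M {\<omega> \<in> space M. (T \<omega>, W \<omega>) \<in> C} =
        emeasure (distr M (S \<Otimes>\<^sub>M R) (\<lambda>\<omega>. (T \<omega>, W \<omega>))) C"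
      by (subst emeasure_distr) (auto intro!: arg_cong[where f="emeasure M"])
    also have "\<dots> = (\<integral>\<^sup>+ w. emeasure (distr M S T) ((\<lambda>x. (x, w)) -` C) \<partial>distr M R W)"
      unfolding D by (rule P.emeasure_pair_measure_alt2) simp
    also have "\<dots> = (\<integral>\<^sup>+ w. emeasure M {\<omega> \<in> space M. (T \<omega>, w) \<in> C} \<partial>distr M R W)"
      by (intro nn_integral_cong, subst emeasure_distr)
         (auto intro!: arg_cong[where f="emeasure M"] sets_Pair2[of _ S R])
    finally show ?thesis .
  qed
  have sp: "T \<omega> \<in> space S" "W \<omega> \<in> space R" if "\<omega> \<in> space M" for \<omega>
    using that measurable_space[OF T] measurable_space[OF W] by auto
  \<comment> \<open>The predicate form only looks at points of the product space and leaves its side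
    condition to the method \<open>measurable\<close>.\<close>
  have fubini': "emeasure M {\<omega> \<in> space M. P (T \<omega>) (W \<omega>)} =
      (\<integral>\<^sup>+ w. emeasure M {\<omega> \<in> space M. P (T \<omega>) w} \<partial>distr M R W)"
    if P: "{x \<in> space (S \<Otimes>\<^sub>M R). P (fst x) (snd x)} \<in> sets (S \<Otimes>\<^sub>M R)" for P
  proof -
    have "emeasure M {\<omega> \<in> space M. P (T \<omega>) (W \<omega>)} =
        emeasure M {\<omega> \<in> space M. (T \<omega>, W \<omega>) \<in> {x \<in> space (S \<Otimes>\<^sub>M R). P (fst x) (snd x)}}"
      using sp by (intro arg_cong[where f="emeasure M"]) (auto simp: space_pair_measure)
    also have "\<dots> = (\<integral>\<^sup>+ w. emeasure M {\<omega> \<in> space M. P (T \<omega>) w} \<partial>distr M R W)"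
      unfolding fubini[OF P] using sp
      by (intro nn_integral_cong arg_cong[where f="emeasure M"]) (auto simp: space_pair_measure)
    finally show ?thesis .
  qed
  have sec: "emeasure M {\<omega> \<in> space M. f (T \<omega>) \<in> A \<and> (h (T \<omega>), w) \<in> B} =
      emeasure M {\<omega> \<in> space M. f (T \<omega>) \<in> A} * emeasure M {\<omega> \<in> space M. (h (T \<omega>), w) \<in> B}"
    if "w \<in> space R" for w
  proof -
    have "(\<lambda>y. (y, w)) -` B \<in> sets N'"
      using B by (rule sets_Pair2)
    from indep_varD[OF fh A this] show ?thesis
      by (simp add: emeasure_eq_measure ennreal_mult[symmetric] vimage_def Int_def conj_commute)
  qed
  have "emeasure M {\<omega> \<in> space M. f (T \<omega>) \<in> A \<and> (h (T \<omega>), W \<omega>) \<in> B} =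
      (\<integral>\<^sup>+ w. emeasure M {\<omega> \<in> space M. f (T \<omega>) \<in> A \<and> (h (T \<omega>), w) \<in> B} \<partial>distr M R W)"
    by (rule fubini') measurable
  also have "\<dots> = (\<integral>\<^sup>+ w. emeasure M {\<omega> \<in> space M. f (T \<omega>) \<in> A} *
      emeasure M {\<omega> \<in> space M. (h (T \<omega>), w) \<in> B} \<partial>distr M R W)"
    by (intro nn_integral_cong sec) simp
  also have "\<dots> = emeasure M {\<omega> \<in> space M. f (T \<omega>) \<in> A} *
      (\<integral>\<^sup>+ w. emeasure M {\<omega> \<in> space M. (h (T \<omega>), w) \<in> B} \<partial>distr M R W)"
    by (rule nn_integral_cmult) measurable
  also have "(\<integral>\<^sup>+ w. emeasure M {\<omega> \<in> space M. (h (T \<omega>), w) \<in> B} \<partial>distr M R W) =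
      emeasure M {\<omega> \<in> space M. (h (T \<omega>), W \<omega>) \<in> B}"
    by (rule fubini'[symmetric]) measurable
  finally show ?thesis
    by (simp add: emeasure_eq_measure ennreal_mult[symmetric])
qed

text \<open>An unbounded support has points of arbitrarily large absolute value. They are not
  negative, since the negative half-line has no mass, and every neighbourhood of such a point has
  positive mass.\<close>

lemma (in prob_space) prob_greater_of_unbounded_support:
  fixes X :: "'a \<Rightarrow> real"
  assumes [measurable]: "X \<in> borel_measurable M"
    and nonneg: "\<And>\<omega>. \<omega> \<in> space M \<Longrightarrow> 0 \<le> X \<omega>"
    and unbounded: "\<not> bounded (topological_support (distr M borel X))"
  shows "0 < prob {\<omega> \<in> space M. c < X \<omega>}"
proof -
  obtain x where x: "x \<in> topological_support (distr M borel X)" "\<not> norm x \<le> max c 0"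
    using unbounded unfolding bounded_iff by blast
  have pos: "0 < prob {\<omega> \<in> space M. X \<omega> \<in> S}" if "open S" "x \<in> S" for S
  proof -
    have [measurable]: "S \<in> sets borel"
      using that by simp
    have "0 < emeasure (distr M borel X) S"
      using x(1) that by (auto simp: topological_support_def)
    also have "\<dots> = emeasure M {\<omega> \<in> space M. X \<omega> \<in> S}"
      by (subst emeasure_distr) (auto intro!: arg_cong[where f="emeasure M"])
    finally show ?thesis
      by (simp add: emeasure_eq_measure)
  qed
  have "\<not> x < 0"
  proof
    assume "x < 0"
    then have "0 < prob {\<omega> \<in> space M. X \<omega> \<in> {..<0}}"
      by (intro pos) auto
    moreover have "{\<omega> \<in> space M. X \<omega> \<in> {..<0}} = {}"
      using nonneg by force
    ultimately show False
      by (metis less_irrefl measure_empty)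
  qed
  then have "c < x"
    using x(2) by auto
  then show ?thesis
    using pos[of "{c<..}"] by simp
qed

section \<open>Inversion and recurrence for ergodic automorphisms\<close>

context ergodic_automorphism
begin

abbreviation \<theta>inv :: "'a \<Rightarrow> 'a" where
  "\<theta>inv \<equiv> inv_into (space M) \<theta>"

lemma theta_space [simp]: "\<omega> \<in> space M \<Longrightarrow> \<theta> \<omega> \<in> space M"
  using measurable_space[OF measurable_theta] .

lemma theta_inv_space [simp]: "\<omega> \<in> space M \<Longrightarrow> \<theta>inv \<omega> \<in> space M"
  using measurable_space[OF measurable_inverse] .

lemma theta_inv_theta [simp]: "\<omega> \<in> space M \<Longrightarrow> \<theta>inv (\<theta> \<omega>) = \<omega>"
  using bij_betw_inv_into_left[OF bij] .

lemma theta_theta_inv [simp]: "\<omega> \<in> space M \<Longrightarrow> \<theta> (\<theta>inv \<omega>) = \<omega>"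
  using bij_betw_inv_into_right[OF bij] .

lemma measurable_funpow: "f \<in> measurable M M \<Longrightarrow> f ^^ n \<in> measurable M M"
  by (induction n) (auto intro: measurable_comp)

lemma funpow_theta_space [simp]: "\<omega> \<in> space M \<Longrightarrow> (\<theta> ^^ n) \<omega> \<in> space M"
  using measurable_space[OF measurable_funpow[OF measurable_theta]] .

lemma funpow_theta_inv_space [simp]: "\<omega> \<in> space M \<Longrightarrow> (\<theta>inv ^^ n) \<omega> \<in> space M"
  using measurable_space[OF measurable_funpow[OF measurable_inverse]] .

text \<open>This makes forward statements about orbits available for the past. Ergodicity carries
  over because every set invariant under the inverse is invariant under
  \<open>\<theta>\<close>.\<close>

lemma ergodic_automorphism_inverse: "ergodic_automorphism M \<theta>inv"
proof
  show "bij_betw \<theta>inv (space M) (space M)"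
    by (rule bij_betw_inv_into[OF bij])
  show "\<theta>inv \<in> measurable M M"
    by (rule measurable_inverse)
  \<comment> \<open>The double inverse is compared with \<open>\<theta>\<close> on
    \<open>space M\<close> only, which is all that measurability sees.\<close>
  have "inv_into (space M) \<theta>inv \<omega> = \<theta> \<omega>" if "\<omega> \<in> space M" for \<omega>
    using bij_betw_inv_into_left[OF \<open>bij_betw \<theta>inv (space M) (space M)\<close> theta_space[OF that]]
    unfolding theta_inv_theta[OF that] .
  then show "inv_into (space M) \<theta>inv \<in> measurable M M"
    using measurable_theta by (simp cong: measurable_cong)
  have "distr M M \<theta>inv = distr (distr M M \<theta>) M \<theta>inv"
    by (simp add: preserving)
  also have "\<dots> = distr M M (\<lambda>\<omega>. \<omega>)"
    unfolding distr_distr[OF measurable_inverse measurable_theta]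
    by (rule distr_cong) auto
  also have "\<dots> = M"
    by (rule distr_id)
  finally show "distr M M \<theta>inv = M" .
next
  fix A
  assume A: "A \<in> sets M" "\<theta>inv -` A \<inter> space M = A"
  have "\<theta> -` A \<inter> space M = A"
  proof (intro set_eqI)
    fix \<omega>
    have "\<theta> \<omega> \<in> A \<longleftrightarrow> \<omega> \<in> A" if "\<omega> \<in> space M"
    proof -
      have "\<theta> \<omega> \<in> A \<longleftrightarrow> \<theta> \<omega> \<in> \<theta>inv -` A \<inter> space M"
        unfolding A(2) ..
      then show ?thesis
        using that by simp
    qed
    then show "\<omega> \<in> \<theta> -` A \<inter> space M \<longleftrightarrow> \<omega> \<in> A"
      using sets.sets_into_space[OF A(1)] by auto
  qed
  with A(1) show "prob A = 0 \<or> prob A = 1"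
    by (rule ergodic)
qed

lemma AE_theta:
  assumes "AE \<omega> in M. P \<omega>"
  shows "AE \<omega> in M. P (\<theta> \<omega>)"
  using AE_distrD[OF measurable_theta, unfolded preserving, OF assms] .

lemma AE_funpow_theta:
  assumes "AE \<omega> in M. P \<omega>"
  shows "AE \<omega> in M. \<forall>n. P ((\<theta> ^^ n) \<omega>)"
  unfolding AE_all_countable
proof
  show "AE \<omega> in M. P ((\<theta> ^^ n) \<omega>)" for n
  proof (induction n)
    case (Suc n)
    from AE_theta[OF this] show ?case
      unfolding funpow_Suc_right o_apply .
  next
    case 0
    from assms show ?case
      unfolding funpow_0 .
  qed
qed

text \<open>The events \<open>B m\<close> of a visit at time \<open>m\<close> or later decrease and,
  by invariance of the measure, share one probability. So their intersection \<open>L\<close> is at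
  least as probable as \<open>A\<close>; being invariant, it has probability one by
  ergodicity.\<close>

lemma recurrence:
  assumes A [measurable]: "A \<in> sets M" and pos: "0 < prob A"
  shows "AE \<omega> in M. \<exists>\<^sub>\<infinity>n. (\<theta> ^^ n) \<omega> \<in> A"
proof -
  have [measurable]: "\<theta> ^^ n \<in> measurable M M" for n
    by (rule measurable_funpow[OF measurable_theta])
  define B where "B m = {\<omega> \<in> space M. \<exists>n\<ge>m. (\<theta> ^^ n) \<omega> \<in> A}" for m
  define L where "L = {\<omega> \<in> space M. \<exists>\<^sub>\<infinity>n. (\<theta> ^^ n) \<omega> \<in> A}"
  have B [measurable]: "B m \<in> sets M" for m
    unfolding B_def by measurable
  have BL: "(\<Inter>m. B m) = L"
    by (auto simp: B_def L_def INFM_nat_le)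
  have L: "L \<in> sets M"
    unfolding BL[symmetric] by measurable
  have "B (Suc m) = \<theta> -` B m \<inter> space M" for m
  proof -
    have *: "(\<exists>n\<ge>Suc m. Q n) \<longleftrightarrow> (\<exists>n\<ge>m. Q (Suc n))" for Q :: "nat \<Rightarrow> bool"
      by (auto dest: Suc_le_D)
    show ?thesis
      unfolding B_def * by (auto simp: funpow_swap1)
  qed
  then have "prob (B (Suc m)) = prob (B m)" for m
    using measure_distr[OF measurable_theta B[of m]] by (simp add: preserving)
  then have const: "prob (B m) = prob (B 0)" for m
    by (induction m) auto
  have "(\<lambda>m. prob (B m)) \<longlonglongrightarrow> prob (\<Inter>m. B m)"
    by (intro finite_Lim_measure_decseq) (auto simp: B_def decseq_def intro: order_trans)
  moreover have "(\<lambda>m. prob (B m)) = (\<lambda>m. prob (B 0))"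
    by (intro ext const)
  ultimately have "prob L = prob (B 0)"
    unfolding BL by (simp only: LIMSEQ_const_iff)
  moreover have "prob A \<le> prob (B 0)"
  proof (intro finite_measure_mono B subsetI)
    fix \<omega> assume "\<omega> \<in> A"
    then have "\<omega> \<in> space M" "(\<theta> ^^ 0) \<omega> \<in> A"
      using sets.sets_into_space[OF A] by auto
    then show "\<omega> \<in> B 0"
      unfolding B_def by blast
  qed
  moreover have "\<theta> -` L \<inter> space M = L"
  proof -
    \<comment> \<open>Dropping the first term of a sequence does not change whether it visits
      \<open>A\<close> infinitely often.\<close>
    have "(\<exists>\<^sub>\<infinity>n. (\<theta> ^^ n) (\<theta> \<omega>) \<in> A) \<longleftrightarrow> (\<exists>\<^sub>\<infinity>n. (\<theta> ^^ n) \<omega> \<in> A)" for \<omega>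
      using eventually_sequentially_Suc[of "\<lambda>n. (\<theta> ^^ n) \<omega> \<notin> A"]
      unfolding cofinite_eq_sequentially frequently_def funpow_Suc_right o_apply by simp
    then show ?thesis
      by (auto simp: L_def)
  qed
  ultimately have "prob L = 1"
    using ergodic[OF L] pos by auto
  then show ?thesis
    using AE_prob_1[of L] by (auto simp: L_def)
qed

end

section \<open>Residual services and their bounds\<close>

locale loss_system = ergodic_automorphism M \<theta> for M :: "'a measure" and \<theta> +
  fixes \<sigma> \<tau> :: "'a \<Rightarrow> real" and p :: nat
  assumes measurable_sigma [measurable]: "\<sigma> \<in> borel_measurable M"
    and measurable_tau [measurable]: "\<tau> \<in> borel_measurable M"
    and tau_nonneg: "\<And>\<omega>. \<omega> \<in> space M \<Longrightarrow> 0 \<le> \<tau> \<omega>"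
begin

abbreviation bound :: "nat \<Rightarrow> 'a \<Rightarrow> ereal" where
  "bound \<equiv> Z M \<theta> \<sigma> \<tau>"

definition residual :: "nat \<Rightarrow> 'a \<Rightarrow> real" where
  "residual k \<omega> = \<sigma> (shift M \<theta> (- int k) \<omega>) - (\<Sum>i=1..k. \<tau> (shift M \<theta> (- int i) \<omega>))"

lemma measurable_bound [measurable]: "bound l \<in> borel_measurable M"
  by (rule measurable_Z) measurable

lemma bound_eq: "bound l \<omega> = max (SUP k\<in>{l..}. ereal (residual k \<omega>)) 0"
  by (simp add: Z_def residual_def)

lemma bound_nonneg: "0 \<le> bound l \<omega>"
  by (simp add: bound_eq)

lemma bound_le_iff: "bound l \<omega> \<le> c \<longleftrightarrow> 0 \<le> c \<and> (\<forall>k\<ge>l. ereal (residual k \<omega>) \<le> c)"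
  by (auto simp: bound_eq SUP_le_iff)

lemma residual_le_bound: "l \<le> k \<Longrightarrow> ereal (residual k \<omega>) \<le> bound l \<omega>"
  using bound_le_iff[of l \<omega> "bound l \<omega>"] by simp

lemma bound_antimono: "l \<le> m \<Longrightarrow> bound m \<omega> \<le> bound l \<omega>"
  unfolding bound_le_iff[of m] by (auto intro: bound_nonneg residual_le_bound)

lemma shift_neg_Suc_theta:
  assumes "\<omega> \<in> space M"
  shows "shift M \<theta> (- int (Suc k)) (\<theta> \<omega>) = shift M \<theta> (- int k) \<omega>"
proof -
  have "shift M \<theta> (- int n) = \<theta>inv ^^ n" for n
    by (cases "n = 0") (simp_all add: shift_def)
  then show ?thesis
    using assms by (simp only: funpow_Suc_right o_apply theta_inv_theta)
qed

lemma residual_0: "residual 0 \<omega> = \<sigma> \<omega>"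
  by (simp add: residual_def shift_def)

text \<open>Seen from \<open>\<theta> \<omega>\<close>, every customer is older by one, and the
  extra summand, the one of index \<open>1\<close>, is \<open>\<tau> \<omega>\<close>.\<close>

lemma residual_Suc_theta:
  assumes "\<omega> \<in> space M"
  shows "residual (Suc k) (\<theta> \<omega>) = residual k \<omega> - \<tau> \<omega>"
proof -
  have "(\<Sum>i=1..Suc k. \<tau> (shift M \<theta> (- int i) (\<theta> \<omega>))) =
      (\<Sum>i=0..k. \<tau> (shift M \<theta> (- int (Suc i)) (\<theta> \<omega>)))"
    using sum.shift_bounds_cl_Suc_ivl[of "\<lambda>i. \<tau> (shift M \<theta> (- int i) (\<theta> \<omega>))" 0 k] by simp
  also have "\<dots> = (\<Sum>i=0..k. \<tau> (shift M \<theta> (- int i) \<omega>))"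
    unfolding shift_neg_Suc_theta[OF assms] ..
  also have "\<dots> = \<tau> \<omega> + (\<Sum>i=1..k. \<tau> (shift M \<theta> (- int i) \<omega>))"
    by (simp add: sum.atLeast_Suc_atMost shift_def)
  finally show ?thesis
    unfolding residual_def shift_neg_Suc_theta[OF assms] by simp
qed

text \<open>Ages at least \<open>l\<close> become ages at least \<open>Suc l\<close>. Only an
  inequality holds in general, because of the truncation at zero, which
  \<open>\<tau> \<omega> \<ge> 0\<close> takes care of.\<close>

lemma bound_Suc_theta:
  assumes "\<omega> \<in> space M"
  shows "bound l \<omega> - ereal (\<tau> \<omega>) \<le> bound (Suc l) (\<theta> \<omega>)"
proof -
  have "bound l \<omega> \<le> bound (Suc l) (\<theta> \<omega>) + ereal (\<tau> \<omega>)"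
    unfolding bound_le_iff[of l]
  proof (intro conjI allI impI)
    show "0 \<le> bound (Suc l) (\<theta> \<omega>) + ereal (\<tau> \<omega>)"
      using bound_nonneg[of "Suc l" "\<theta> \<omega>"] tau_nonneg[OF assms] by simp
    fix k assume "l \<le> k"
    then have "ereal (residual (Suc k) (\<theta> \<omega>)) \<le> bound (Suc l) (\<theta> \<omega>)"
      by (intro residual_le_bound) simp
    from add_right_mono[OF this, of "ereal (\<tau> \<omega>)"]
    show "ereal (residual k \<omega>) \<le> bound (Suc l) (\<theta> \<omega>) + ereal (\<tau> \<omega>)"
      by (simp add: residual_Suc_theta[OF assms])
  qed
  then show ?thesis
    by (simp add: ereal_minus_le_iff add.commute)
qed

lemma arrival_le_bound:
  assumes "\<omega> \<in> space M"
  shows "ereal (\<sigma> \<omega> - \<tau> \<omega>) \<le> bound 1 (\<theta> \<omega>)"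
  using residual_le_bound[of 1 1 "\<theta> \<omega>"] residual_Suc_theta[OF assms, of 0] by (simp add: residual_0)

text \<open>If the coming interarrival time covers all residuals, including age \<open>0\<close> for
  the customer just arriving, all work is done by the next arrival. This is how an empty state will
  be produced.\<close>

lemma bound_1_theta_eq_0:
  assumes "\<omega> \<in> space M" "\<And>k. residual k \<omega> \<le> \<tau> \<omega>"
  shows "bound 1 (\<theta> \<omega>) = 0"
proof -
  have "residual k (\<theta> \<omega>) \<le> 0" if "1 \<le> k" for k
    using assms(2)[of "k - 1"] residual_Suc_theta[OF assms(1), of "k - 1"] that by simp
  then have "bound 1 (\<theta> \<omega>) \<le> 0"
    by (simp add: bound_le_iff zero_ereal_def)
  then show ?thesis
    using bound_nonneg by (rule antisym)
qed

section \<open>Systems started empty and the candidate solution\<close>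

text \<open>\<open>workload n \<omega>\<close> is the state at \<open>\<omega>\<close> of the system started empty at \<open>\<theta>\<^sup>-\<^sup>n \<omega>\<close>.\<close>

primrec workload :: "nat \<Rightarrow> 'a \<Rightarrow> real list" where
  "workload 0 \<omega> = replicate p 0"
| "workload (Suc n) \<omega> = loss_map (\<sigma> (\<theta>inv \<omega>)) (\<tau> (\<theta>inv \<omega>)) (workload n (\<theta>inv \<omega>))"

lemma workload_ordered_nonneg: "workload n \<omega> \<in> ordered_nonneg p"
proof (induction n arbitrary: \<omega>)
  case 0
  show ?case
    by (auto simp: ordered_nonneg_def)
qed (simp add: loss_map_ordered_nonneg)

lemma length_workload: "length (workload n \<omega>) = p"
  using workload_ordered_nonneg[of n \<omega>] by (simp add: ordered_nonneg_def)

lemma workload_Suc_theta: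
  "\<omega> \<in> space M \<Longrightarrow> workload (Suc n) (\<theta> \<omega>) = loss_map (\<sigma> \<omega>) (\<tau> \<omega>) (workload n \<omega>)"
  by simp

text \<open>The constant \<open>c\<close> carries what is left of an arbitrary initial state: it is
  common to all coordinates and shrinks by \<open>\<tau> \<omega>\<close> in the step, while the
  bounds reproduce themselves.\<close>

lemma loss_map_le_max_bound:
  assumes \<omega>: "\<omega> \<in> space M" and u: "u \<in> ordered_nonneg p"
    and bnd: "\<And>i. i < p \<Longrightarrow> ereal (u ! i) \<le> max (bound (p - i) \<omega>) (ereal c)"
    and i: "i < p"
  shows "ereal (loss_map (\<sigma> \<omega>) (\<tau> \<omega>) u ! i) \<le> max (bound (p - i) (\<theta> \<omega>)) (ereal (c - \<tau> \<omega>))"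
proof (rule loss_map_le_bound[OF u, where b="\<lambda>l. max (bound l \<omega>) (ereal c)"
      and b'="\<lambda>l. max (bound l (\<theta> \<omega>)) (ereal (c - \<tau> \<omega>))"])
  show "max (bound l \<omega>) (ereal c) - ereal (\<tau> \<omega>) \<le> max (bound (Suc l) (\<theta> \<omega>)) (ereal (c - \<tau> \<omega>))" for l
    using bound_Suc_theta[OF \<omega>, of l] by (cases "bound l \<omega> \<le> ereal c") (auto simp: max_def le_max_iff_disj)
  show "ereal (\<sigma> \<omega> - \<tau> \<omega>) \<le> max (bound 1 (\<theta> \<omega>)) (ereal (c - \<tau> \<omega>))"
    using arrival_le_bound[OF \<omega>] by (simp add: le_max_iff_disj)
  show "max (bound (Suc l) (\<theta> \<omega>)) (ereal (c - \<tau> \<omega>)) \<le> max (bound l (\<theta> \<omega>)) (ereal (c - \<tau> \<omega>))" for l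
    by (intro max.mono bound_antimono) auto
qed (use bnd i bound_nonneg in \<open>auto simp: le_max_iff_disj\<close>)

lemma workload_le_bound:
  assumes "\<omega> \<in> space M" "i < p"
  shows "ereal (workload n \<omega> ! i) \<le> bound (p - i) \<omega>"
  using assms
proof (induction n arbitrary: \<omega> i)
  case 0
  then show ?case
    using bound_nonneg by (simp add: zero_ereal_def)
next
  case (Suc n)
  have "ereal (loss_map (\<sigma> (\<theta>inv \<omega>)) (\<tau> (\<theta>inv \<omega>)) (workload n (\<theta>inv \<omega>)) ! i)
      \<le> max (bound (p - i) (\<theta> (\<theta>inv \<omega>))) (ereal (0 - \<tau> (\<theta>inv \<omega>)))"
    using Suc by (intro loss_map_le_max_bound) (auto simp: le_max_iff_disj intro: workload_ordered_nonneg)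
  \<comment> \<open>For an empty start \<open>c = 0\<close> is used; the term it leaves is
    non-positive and disappears in the bound.\<close>
  moreover have "ereal (0 - \<tau> (\<theta>inv \<omega>)) \<le> bound (p - i) \<omega>"
    using bound_nonneg[of "p - i" \<omega>] tau_nonneg[of "\<theta>inv \<omega>"] Suc.prems
    by (auto intro: order_trans[of _ 0] simp: zero_ereal_def)
  ultimately show ?case
    using Suc.prems by auto
qed

text \<open>The bounds decrease in their index, so all of them vanish together with the
  first.\<close>

lemma eq_replicate_0:
  assumes "u \<in> ordered_nonneg p" "\<And>i. i < p \<Longrightarrow> ereal (u ! i) \<le> bound (p - i) \<omega>" "bound 1 \<omega> = 0"
  shows "u = replicate p 0"
proof (rule nth_equalityI)
  show "length u = length (replicate p 0)"
    using assms(1) by (simp add: ordered_nonneg_def)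
  fix i assume "i < length u"
  then have i: "i < p"
    using assms(1) by (simp add: ordered_nonneg_def)
  have "bound (p - i) \<omega> \<le> 0"
    unfolding assms(3)[symmetric] using i by (intro bound_antimono) simp
  with assms(2)[OF i] have "ereal (u ! i) \<le> 0"
    by (rule order_trans)
  moreover have "0 \<le> u ! i"
    using assms(1) i by (auto simp: ordered_nonneg_def)
  ultimately show "u ! i = replicate p 0 ! i"
    using i by (simp add: zero_ereal_def)
qed

text \<open>A system started \<open>m\<close> steps earlier obeys the bounds too, hence is itself
  empty when \<open>bound 1\<close> vanishes; from then on both follow the same recursion.\<close>

lemma workload_after_empty:
  assumes "\<omega> \<in> space M" "bound 1 ((\<theta>inv ^^ N) \<omega>) = 0"
  shows "workload (N + m) \<omega> = workload N \<omega>"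
  using assms
proof (induction N arbitrary: \<omega>)
  case 0
  then show ?case
    by (auto intro!: eq_replicate_0[of _ \<omega>] workload_ordered_nonneg workload_le_bound)
next
  case (Suc N)
  then have "bound 1 ((\<theta>inv ^^ N) (\<theta>inv \<omega>)) = 0"
    by (simp only: funpow_Suc_right o_apply)
  then have "workload (N + m) (\<theta>inv \<omega>) = workload N (\<theta>inv \<omega>)"
    using Suc by (intro Suc.IH) auto
  then show ?case
    by simp
qed

lemma workload_eq_of_empty:
  assumes "\<omega> \<in> space M" "bound 1 ((\<theta>inv ^^ N) \<omega>) = 0" "N \<le> n"
  shows "workload n \<omega> = workload N \<omega>"
  using workload_after_empty[OF assms(1,2), of "n - N"] assms(3) by simp

text \<open>Taking the most recent visit is a mere choice. Where there is no visit,
  \<open>LEAST\<close> is some unspecified number, and the value is still an ordered non-negative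
  vector.\<close>

definition stationary_workload :: "'a \<Rightarrow> real list" where
  "stationary_workload \<omega> = workload (LEAST n. bound 1 ((\<theta>inv ^^ n) \<omega>) = 0) \<omega>"

lemma stationary_workload_eq:
  assumes "\<omega> \<in> space M" "bound 1 ((\<theta>inv ^^ N) \<omega>) = 0" "N \<le> n"
  shows "stationary_workload \<omega> = workload n \<omega>"
proof -
  define L where "L = (LEAST n. bound 1 ((\<theta>inv ^^ n) \<omega>) = 0)"
  have "bound 1 ((\<theta>inv ^^ L) \<omega>) = 0" "L \<le> N"
    unfolding L_def using assms(2) by (auto intro: LeastI Least_le)
  then show ?thesis
    using workload_eq_of_empty[OF assms(1), of L n] assms(3)
    by (simp add: stationary_workload_def L_def)
qed

text \<open>A visit \<open>N\<close> steps before \<open>\<omega>\<close> lies \<open>Suc N\<close>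
  steps before \<open>\<theta> \<omega>\<close>, so both values can be read off systems with the
  same starting point.\<close>

lemma stationary_workload_theta:
  assumes "\<omega> \<in> space M" "bound 1 ((\<theta>inv ^^ N) \<omega>) = 0"
  shows "stationary_workload (\<theta> \<omega>) = loss_map (\<sigma> \<omega>) (\<tau> \<omega>) (stationary_workload \<omega>)"
proof -
  have "bound 1 ((\<theta>inv ^^ Suc N) (\<theta> \<omega>)) = 0"
    using assms by (simp only: funpow_Suc_right o_apply theta_inv_theta)
  then have "stationary_workload (\<theta> \<omega>) = workload (Suc N) (\<theta> \<omega>)"
    using assms(1) by (intro stationary_workload_eq[OF _ _ order_refl]) auto
  also have "\<dots> = loss_map (\<sigma> \<omega>) (\<tau> \<omega>) (workload N \<omega>)"
    by (rule workload_Suc_theta[OF assms(1)])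
  also have "workload N \<omega> = stationary_workload \<omega>"
    using stationary_workload_eq[OF assms order_refl] by simp
  finally show ?thesis .
qed

lemma measurable_workload:
  assumes "i < p"
  shows "(\<lambda>\<omega>. workload n \<omega> ! i) \<in> borel_measurable M"
  using assms
proof (induction n arbitrary: i)
  case 0
  then show ?case
    by simp
next
  case (Suc n)
  have "(\<lambda>\<omega>. loss_map (\<sigma> \<omega>) (\<tau> \<omega>) (workload n \<omega>) ! i) \<in> borel_measurable M"
    using Suc by (intro measurable_loss_map_nth[where p=p]) (auto simp: length_workload)
  from measurable_compose[OF measurable_inverse this] show ?case
    by simp
qed

lemma ordered_random_vector_stationary_workload:
  "ordered_random_vector M p stationary_workload"
  unfolding ordered_random_vector_def
proof (intro conjI ballI allI impI)
  show "stationary_workload \<omega> \<in> ordered_nonneg p" for \<omega>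
    unfolding stationary_workload_def by (rule workload_ordered_nonneg)
  fix i assume i: "i < p"
  have [measurable]: "\<theta>inv ^^ n \<in> measurable M M" for n
    by (rule measurable_funpow[OF measurable_inverse])
  show "(\<lambda>\<omega>. stationary_workload \<omega> ! i) \<in> borel_measurable M"
    unfolding stationary_workload_def
  \<comment> \<open>The chosen visit is measurable with countably many values, and for each fixed
    value the coordinate is measurable.\<close>
  proof (rule measurable_compose_countable[where f="\<lambda>n \<omega>. workload n \<omega> ! i"])
    show "(\<lambda>\<omega>. LEAST n. bound 1 ((\<theta>inv ^^ n) \<omega>) = 0) \<in> measurable M (count_space UNIV)"
      by measurable
  qed (rule measurable_workload[OF i])
qed

section \<open>Bounds for arbitrary solutions\<close>

text \<open>By recurrence \<open>\<tau> > 1\<close> occurs infinitely often along almost every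
  orbit; each occurrence adds more than \<open>1\<close>, and the other terms are
  non-negative.\<close>

lemma AE_sum_tau_at_top:
  assumes pos: "0 < prob {\<omega> \<in> space M. 1 < \<tau> \<omega>}"
  shows "AE \<omega> in M. \<forall>c. \<exists>N. \<forall>n\<ge>N. c \<le> (\<Sum>k<n. \<tau> ((\<theta> ^^ k) \<omega>))"
proof -
  have "AE \<omega> in M. \<exists>\<^sub>\<infinity>n. (\<theta> ^^ n) \<omega> \<in> {\<omega> \<in> space M. 1 < \<tau> \<omega>}"
    using pos by (intro recurrence) measurable
  then show ?thesis
    using AE_space
  proof eventually_elim
    fix \<omega> assume inf: "\<exists>\<^sub>\<infinity>n. (\<theta> ^^ n) \<omega> \<in> {\<omega> \<in> space M. 1 < \<tau> \<omega>}" and \<omega>: "\<omega> \<in> space M"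
    show "\<forall>c. \<exists>N. \<forall>n\<ge>N. c \<le> (\<Sum>k<n. \<tau> ((\<theta> ^^ k) \<omega>))"
    proof
      fix c :: real
      have "infinite {n. (\<theta> ^^ n) \<omega> \<in> {\<omega> \<in> space M. 1 < \<tau> \<omega>}}"
        using inf by (simp add: frequently_cofinite)
      then obtain K where K: "K \<subseteq> {n. (\<theta> ^^ n) \<omega> \<in> {\<omega> \<in> space M. 1 < \<tau> \<omega>}}" "finite K" "card K = nat \<lceil>c\<rceil>"
        using infinite_arbitrarily_large[of _ "nat \<lceil>c\<rceil>"] by blast
      obtain N where N: "K \<subseteq> {..<N}"
        using K(2) finite_nat_iff_bounded by auto
      have "c \<le> (\<Sum>k<n. \<tau> ((\<theta> ^^ k) \<omega>))" if "N \<le> n" for n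
      proof -
        have "c \<le> real (card K)"
          using K(3) by linarith
        also have "\<dots> = (\<Sum>k\<in>K. 1)"
          by simp
        also have "\<dots> \<le> (\<Sum>k\<in>K. \<tau> ((\<theta> ^^ k) \<omega>))"
          using K(1) by (intro sum_mono) auto
        also have "\<dots> \<le> (\<Sum>k<n. \<tau> ((\<theta> ^^ k) \<omega>))"
          using N that \<omega> by (intro sum_mono2) (auto intro: tau_nonneg)
        finally show ?thesis .
      qed
      then show "\<exists>N. \<forall>n\<ge>N. c \<le> (\<Sum>k<n. \<tau> ((\<theta> ^^ k) \<omega>))"
        by blast
    qed
  qed
qed

text \<open>Along the forward orbit, what is left of the initial workload is eventually exhausted, so
  the event that the bound fails is visited finitely often; by recurrence it is null.\<close>

lemma solution_le_bound:
  assumes V: "loss_solution M \<theta> \<sigma> \<tau> p V"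
    and pos: "0 < prob {\<omega> \<in> space M. 1 < \<tau> \<omega>}"
  shows "AE \<omega> in M. \<forall>i<p. ereal (V \<omega> ! i) \<le> bound (p - i) \<omega>"
proof -
  have ord: "V \<omega> \<in> ordered_nonneg p" if "\<omega> \<in> space M" for \<omega>
    using V that by (auto simp: loss_solution_def ordered_random_vector_def)
  have [measurable]: "(\<lambda>\<omega>. V \<omega> ! i) \<in> borel_measurable M" if "i \<in> {..<p}" for i
    using V that by (auto simp: loss_solution_def ordered_random_vector_def)
  define E where "E = {\<omega> \<in> space M. \<not> (\<forall>i\<in>{..<p}. ereal (V \<omega> ! i) \<le> bound (p - i) \<omega>)}"
  have E [measurable]: "E \<in> sets M"
    unfolding E_def by measurable
  have "AE \<omega> in M. V (\<theta> \<omega>) = loss_map (\<sigma> \<omega>) (\<tau> \<omega>) (V \<omega>)"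
    using V by (simp add: loss_solution_def)
  note AE_funpow_theta[OF this]
  then have not_io: "AE \<omega> in M. \<not> (\<exists>\<^sub>\<infinity>n. (\<theta> ^^ n) \<omega> \<in> E)"
    using AE_sum_tau_at_top[OF pos] AE_space
  proof eventually_elim
    fix \<omega>
    assume rec: "\<forall>n. V (\<theta> ((\<theta> ^^ n) \<omega>)) = loss_map (\<sigma> ((\<theta> ^^ n) \<omega>)) (\<tau> ((\<theta> ^^ n) \<omega>)) (V ((\<theta> ^^ n) \<omega>))"
      and sum: "\<forall>c. \<exists>N. \<forall>n\<ge>N. c \<le> (\<Sum>k<n. \<tau> ((\<theta> ^^ k) \<omega>))"
      and \<omega>: "\<omega> \<in> space M"
    \<comment> \<open>The last coordinate of a sorted vector is the largest, so it dominates all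
      initial work.\<close>
    define c where "c = V \<omega> ! (p - 1)"
    have le: "ereal (V ((\<theta> ^^ n) \<omega>) ! i)
        \<le> max (bound (p - i) ((\<theta> ^^ n) \<omega>)) (ereal (c - (\<Sum>k<n. \<tau> ((\<theta> ^^ k) \<omega>))))" if "i < p" for n i
      using that
    proof (induction n arbitrary: i)
      case 0
      have "V \<omega> ! i \<le> c"
        unfolding c_def using ord[OF \<omega>] 0 by (intro sorted_nth_mono) (auto simp: ordered_nonneg_def)
      then show ?case
        by (simp add: le_max_iff_disj)
    next
      case (Suc n)
      have "ereal (V (\<theta> ((\<theta> ^^ n) \<omega>)) ! i) \<le> max (bound (p - i) (\<theta> ((\<theta> ^^ n) \<omega>)))
          (ereal (c - (\<Sum>k<n. \<tau> ((\<theta> ^^ k) \<omega>)) - \<tau> ((\<theta> ^^ n) \<omega>)))"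
        unfolding rec[rule_format] using Suc \<omega>
        by (intro loss_map_le_max_bound ord) auto
      then show ?case
        by (simp add: algebra_simps)
    qed
    obtain N where N: "\<And>n. N \<le> n \<Longrightarrow> c \<le> (\<Sum>k<n. \<tau> ((\<theta> ^^ k) \<omega>))"
      using sum by blast
    have "(\<theta> ^^ n) \<omega> \<notin> E" if "N \<le> n" for n
    proof -
      have "ereal (V ((\<theta> ^^ n) \<omega>) ! i) \<le> bound (p - i) ((\<theta> ^^ n) \<omega>)" if "i < p" for i
      proof -
        have "ereal (c - (\<Sum>k<n. \<tau> ((\<theta> ^^ k) \<omega>))) \<le> bound (p - i) ((\<theta> ^^ n) \<omega>)"
          using N[OF \<open>N \<le> n\<close>] by (intro order_trans[OF _ bound_nonneg]) (simp add: zero_ereal_def)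
        then show ?thesis
          using le[OF that, of n] by (auto simp: max_def split: if_splits)
      qed
      then show ?thesis
        by (simp add: E_def)
    qed
    then show "\<not> (\<exists>\<^sub>\<infinity>n. (\<theta> ^^ n) \<omega> \<in> E)"
      unfolding INFM_nat_le by blast
  qed
  have "\<not> 0 < prob E"
  proof
    assume "0 < prob E"
    from recurrence[OF E this] not_io have "AE \<omega> in M. False"
      by eventually_elim blast
    then show False
      by simp
  qed
  then have "prob E = 0"
    using measure_nonneg[of M E] by linarith
  then have "AE \<omega> in M. \<omega> \<notin> E"
    unfolding prob_eq_0[OF E] .
  then show ?thesis
    using AE_space by eventually_elim (auto simp: E_def)
qed

text \<open>The equation is unrolled along one fixed backward orbit. The exponent
  \<open>Suc n\<close> marks the steps before \<open>\<omega>\<close>, the last of which leads from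
  \<open>\<theta>inv \<omega>\<close> to \<open>\<omega>\<close>.\<close>

lemma solution_eq_workload:
  assumes rec: "\<And>n. V (\<theta> ((\<theta>inv ^^ Suc n) \<omega>)) =
      loss_map (\<sigma> ((\<theta>inv ^^ Suc n) \<omega>)) (\<tau> ((\<theta>inv ^^ Suc n) \<omega>)) (V ((\<theta>inv ^^ Suc n) \<omega>))"
    and empty: "V ((\<theta>inv ^^ N) \<omega>) = replicate p 0"
    and \<omega>: "\<omega> \<in> space M"
  shows "V \<omega> = workload N \<omega>"
  using assms
proof (induction N arbitrary: \<omega>)
  case 0
  then show ?case
    by simp
next
  case (Suc N)
  have "V (\<theta>inv \<omega>) = workload N (\<theta>inv \<omega>)"
  proof (rule Suc.IH)
    show "V (\<theta> ((\<theta>inv ^^ Suc n) (\<theta>inv \<omega>))) = loss_map (\<sigma> ((\<theta>inv ^^ Suc n) (\<theta>inv \<omega>)))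
        (\<tau> ((\<theta>inv ^^ Suc n) (\<theta>inv \<omega>))) (V ((\<theta>inv ^^ Suc n) (\<theta>inv \<omega>)))" for n
      using Suc.prems(1)[of "Suc n"] unfolding funpow_Suc_right o_apply .
    show "V ((\<theta>inv ^^ N) (\<theta>inv \<omega>)) = replicate p 0"
      using Suc.prems(2) unfolding funpow_Suc_right o_apply .
    show "\<theta>inv \<omega> \<in> space M"
      using Suc.prems(3) by simp
  qed
  then show ?case
    using Suc.prems(1)[of 0] Suc.prems(3) by simp
qed

section \<open>Positive probability of the empty state\<close>

lemma measurable_residual [measurable]: "residual k \<in> borel_measurable M"
  unfolding residual_def by measurable

text \<open>The residuals involve interarrival times at negative indices and services at indices up
  to \<open>0\<close>. The interarrival time at index \<open>0\<close> is independent of the former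
  within its own sequence, and the two sequences are independent of each other.\<close>

lemma prob_residual_le_tau_greater:
  assumes GI: "GI_GI M \<theta> \<sigma> \<tau>"
  shows "prob {\<omega> \<in> space M. c < \<tau> \<omega> \<and> (\<forall>k. residual k \<omega> \<le> c)} =
    prob {\<omega> \<in> space M. c < \<tau> \<omega>} * prob {\<omega> \<in> space M. \<forall>k. residual k \<omega> \<le> c}"
proof -
  define T where "T \<omega> = (\<lambda>n. \<tau> (shift M \<theta> n \<omega>))" for \<omega>
  define W where "W \<omega> = (\<lambda>n. \<sigma> (shift M \<theta> n \<omega>))" for \<omega>
  \<comment> \<open>\<open>N\<close> holds the coordinate \<open>0\<close> of the interarrival
    sequence, \<open>N'\<close> its past, and \<open>R\<close> either full sequence.\<close>
  define N where "N = PiM {0::int} (\<lambda>_. borel :: real measure)"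
  define N' where "N' = PiM {..<0::int} (\<lambda>_. borel :: real measure)"
  define R where "R = PiM (UNIV :: int set) (\<lambda>_. borel :: real measure)"
  have TW: "indep_var R T R W"
    using GI by (simp add: GI_GI_def T_def[abs_def] W_def[abs_def] R_def)
  have ind: "indep_vars (\<lambda>_. borel) (\<lambda>n. \<tau> \<circ> shift M \<theta> n) UNIV"
    using GI by (simp add: GI_GI_def iid_def)
  have fh: "indep_var N ((\<lambda>x. restrict x {0}) \<circ> T) N' ((\<lambda>x. restrict x {..<0}) \<circ> T)"
    using indep_var_restrict[OF ind, of "{0}" "{..<0}"]
    by (simp add: N_def N'_def comp_def T_def[abs_def])
  have f: "(\<lambda>x. restrict x {0}) \<in> measurable R N"
    unfolding R_def N_def by (rule measurable_restrict_subset) simp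
  have h: "(\<lambda>x. restrict x {..<0}) \<in> measurable R N'"
    unfolding R_def N'_def by (rule measurable_restrict_subset) simp
  define A where "A = {x \<in> space N. c < x 0}"
  have "(\<lambda>x. x 0) \<in> borel_measurable N"
    unfolding N_def by (rule measurable_component_singleton) simp
  then have A: "A \<in> sets N"
    unfolding A_def by measurable
  define B where "B = {x \<in> space (N' \<Otimes>\<^sub>M R).
    \<forall>k. snd x (- int k) - (\<Sum>i=1..k. fst x (- int i)) \<le> c}"
  have [measurable]: "(\<lambda>x. snd x (- int k)) \<in> borel_measurable (N' \<Otimes>\<^sub>M R)" for k
    unfolding R_def by (rule measurable_compose[OF measurable_snd measurable_component_singleton]) simp
  have "(\<lambda>x. fst x (- int i)) \<in> borel_measurable (N' \<Otimes>\<^sub>M R)" if "i \<in> {1..k}" for i k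
    unfolding N'_def using that
    by (intro measurable_compose[OF measurable_fst measurable_component_singleton]) simp
  then have [measurable]: "(\<lambda>x. \<Sum>i=1..k. fst x (- int i)) \<in> borel_measurable (N' \<Otimes>\<^sub>M R)" for k
    by (intro borel_measurable_sum) blast
  have B: "B \<in> sets (N' \<Otimes>\<^sub>M R)"
    unfolding B_def by measurable
  have iffA: "restrict (T \<omega>) {0} \<in> A \<longleftrightarrow> c < \<tau> \<omega>" if "\<omega> \<in> space M" for \<omega>
    by (simp add: A_def N_def space_PiM T_def shift_def)
  have iffB: "(restrict (T \<omega>) {..<0}, W \<omega>) \<in> B \<longleftrightarrow> (\<forall>k. residual k \<omega> \<le> c)" for \<omega>
  proof -
    \<comment> \<open>The sum starts at \<open>1\<close>, so all its indices are negative and the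
      restriction is invisible.\<close>
    have "(\<Sum>i=1..k. restrict (T \<omega>) {..<0} (- int i)) = (\<Sum>i=1..k. \<tau> (shift M \<theta> (- int i) \<omega>))" for k
      by (intro sum.cong) (auto simp: T_def)
    moreover have "(restrict (T \<omega>) {..<0}, W \<omega>) \<in> space (N' \<Otimes>\<^sub>M R)"
      by (simp add: space_pair_measure N'_def R_def space_PiM)
    ultimately show ?thesis
      by (simp add: B_def residual_def W_def del: restrict_apply)
  qed
  show ?thesis
    using indep_var_prob_triple[OF TW f h fh A B] by (simp add: iffA iffB cong: conj_cong)
qed

text \<open>That the bound of index \<open>l\<close> vanishes is only used to make all residuals bounded.
  Since \<open>\<tau>\<close> is unbounded and independent of them, it then exceeds them all with positive
  probability.\<close>

lemma prob_bound_1_eq_0_pos: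
  assumes GI: "GI_GI M \<theta> \<sigma> \<tau>"
    and tail: "\<And>c. 0 < prob {\<omega> \<in> space M. c < \<tau> \<omega>}"
    and pos: "0 < prob {\<omega> \<in> space M. bound l \<omega> = 0}"
  shows "0 < prob {\<omega> \<in> space M. bound 1 \<omega> = 0}"
proof -
  define A where "A c = {\<omega> \<in> space M. \<forall>k. residual k \<omega> \<le> c}" for c
  have A [measurable]: "A c \<in> sets M" for c
    unfolding A_def by measurable
  have "{\<omega> \<in> space M. bound l \<omega> = 0} \<subseteq> (\<Union>n. A (real n))"
  proof
    fix \<omega> assume "\<omega> \<in> {\<omega> \<in> space M. bound l \<omega> = 0}"
    then have \<omega>: "\<omega> \<in> space M" "bound l \<omega> = 0"
      by auto
    \<comment> \<open>Only finitely many residuals have age below \<open>l\<close>; the others are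
      non-positive on this event. Inserting \<open>0\<close> keeps the maximum meaningful when
      \<open>l = 0\<close>.\<close>
    obtain n where n: "Max (insert 0 ((\<lambda>k. residual k \<omega>) ` {..<l})) \<le> real n"
      using real_arch_simple by blast
    have "residual k \<omega> \<le> real n" for k
    proof (cases "k < l")
      case True
      then show ?thesis
        using n by simp
    next
      case False
      then have "residual k \<omega> \<le> 0"
        using residual_le_bound[of l k \<omega>] \<omega>(2) by (simp add: zero_ereal_def)
      then show ?thesis
        by simp
    qed
    with \<omega>(1) show "\<omega> \<in> (\<Union>n. A (real n))"
      by (auto simp: A_def)
  qed
  then have union_pos: "0 < prob (\<Union>n. A (real n))"
    using pos by (elim less_le_trans[OF _ finite_measure_mono]) auto
  have "\<exists>n. 0 < prob (A (real n))"
  proof (rule ccontr)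
    assume "\<nexists>n. 0 < prob (A (real n))"
    then have "prob (A (real n)) = 0" for n
      by (metis less_le measure_nonneg)
    then have "(\<Union>n. A (real n)) \<in> null_sets M"
      by (intro null_sets_UN) (simp add: null_sets_def emeasure_eq_measure)
    with union_pos show False
      by (simp add: null_sets_def measure_def)
  qed
  then obtain n where n: "0 < prob (A (real n))" ..
  have "0 < prob {\<omega> \<in> space M. real n < \<tau> \<omega> \<and> (\<forall>k. residual k \<omega> \<le> real n)}"
    using tail[of "real n"] n unfolding prob_residual_le_tau_greater[OF GI] A_def by simp
  \<comment> \<open>On this event all work ends before the next arrival, so \<open>bound 1\<close>
    vanishes at \<open>\<theta> \<omega>\<close>; invariance of the measure then removes the
    shift.\<close>
  also have "\<dots> \<le> prob (\<theta> -` {\<omega> \<in> space M. bound 1 \<omega> = 0} \<inter> space M)"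
  proof (rule finite_measure_mono)
    show "{\<omega> \<in> space M. real n < \<tau> \<omega> \<and> (\<forall>k. residual k \<omega> \<le> real n)}
        \<subseteq> \<theta> -` {\<omega> \<in> space M. bound 1 \<omega> = 0} \<inter> space M"
      by (auto intro!: bound_1_theta_eq_0 intro: order_trans less_imp_le simp del: One_nat_def)
    show "\<theta> -` {\<omega> \<in> space M. bound 1 \<omega> = 0} \<inter> space M \<in> sets M"
      by (rule measurable_sets[OF measurable_theta]) measurable
  qed
  also have "\<dots> = prob {\<omega> \<in> space M. bound 1 \<omega> = 0}"
    using measure_distr[OF measurable_theta, of "{\<omega> \<in> space M. bound 1 \<omega> = 0}"]
    by (simp add: preserving)
  finally show ?thesis .
qed

section \<open>Existence and uniqueness of the stationary solution\<close>

text \<open>The visits have to lie in the past, so recurrence is applied to the inverse map.\<close>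

lemma AE_visits_empty:
  assumes "0 < prob {\<omega> \<in> space M. bound 1 \<omega> = 0}"
  shows "AE \<omega> in M. \<exists>N. bound 1 ((\<theta>inv ^^ N) \<omega>) = 0"
proof -
  interpret inverse: ergodic_automorphism M \<theta>inv
    by (rule ergodic_automorphism_inverse)
  have "AE \<omega> in M. \<exists>\<^sub>\<infinity>n. (\<theta>inv ^^ n) \<omega> \<in> {\<omega> \<in> space M. bound 1 \<omega> = 0}"
    using assms by (intro inverse.recurrence) measurable
  then show ?thesis
    by eventually_elim (auto dest: frequently_ex)
qed

lemma loss_solution_stationary_workload:
  assumes "AE \<omega> in M. \<exists>N. bound 1 ((\<theta>inv ^^ N) \<omega>) = 0"
  shows "loss_solution M \<theta> \<sigma> \<tau> p stationary_workload"
  unfolding loss_solution_def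
proof
  show "AE \<omega> in M. stationary_workload (\<theta> \<omega>) = loss_map (\<sigma> \<omega>) (\<tau> \<omega>) (stationary_workload \<omega>)"
    using assms AE_space by eventually_elim (blast intro: stationary_workload_theta)
qed (rule ordered_random_vector_stationary_workload)

text \<open>Almost surely the equation and the bounds hold along the whole backward orbit. At a
  visit the bounds force \<open>V\<close> to be empty, and from there the recursion determines
  it.\<close>

lemma loss_solution_unique:
  assumes V: "loss_solution M \<theta> \<sigma> \<tau> p V"
    and pos: "0 < prob {\<omega> \<in> space M. 1 < \<tau> \<omega>}"
    and visits: "AE \<omega> in M. \<exists>N. bound 1 ((\<theta>inv ^^ N) \<omega>) = 0"
  shows "AE \<omega> in M. V \<omega> = stationary_workload \<omega>"
proof -
  interpret inverse: ergodic_automorphism M \<theta>inv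
    by (rule ergodic_automorphism_inverse)
  have rec: "AE \<omega> in M. V (\<theta> \<omega>) = loss_map (\<sigma> \<omega>) (\<tau> \<omega>) (V \<omega>)"
    using V by (simp add: loss_solution_def)
  show ?thesis
    using inverse.AE_funpow_theta[OF rec] inverse.AE_funpow_theta[OF solution_le_bound[OF V pos]]
      visits AE_space
  proof eventually_elim
    fix \<omega>
    assume rec: "\<forall>n. V (\<theta> ((\<theta>inv ^^ n) \<omega>)) =
        loss_map (\<sigma> ((\<theta>inv ^^ n) \<omega>)) (\<tau> ((\<theta>inv ^^ n) \<omega>)) (V ((\<theta>inv ^^ n) \<omega>))"
      and le: "\<forall>n. \<forall>i<p. ereal (V ((\<theta>inv ^^ n) \<omega>) ! i) \<le> bound (p - i) ((\<theta>inv ^^ n) \<omega>)"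
      and "\<exists>N. bound 1 ((\<theta>inv ^^ N) \<omega>) = 0" and \<omega>: "\<omega> \<in> space M"
    then obtain N where N: "bound 1 ((\<theta>inv ^^ N) \<omega>) = 0"
      by blast
    have "V ((\<theta>inv ^^ N) \<omega>) \<in> ordered_nonneg p"
      using V \<omega> by (auto simp: loss_solution_def ordered_random_vector_def)
    then have "V ((\<theta>inv ^^ N) \<omega>) = replicate p 0"
      using le N by (intro eq_replicate_0) blast+
    then have "V \<omega> = workload N \<omega>"
      using rec \<omega> by (intro solution_eq_workload) blast+
    then show "V \<omega> = stationary_workload \<omega>"
      using stationary_workload_eq[OF \<omega> N order_refl] by simp
  qed
qed

end

theorem theorem2:
  fixes M :: "'a measure" and \<theta> :: "'a \<Rightarrow> 'a"
    and \<sigma> \<tau> :: "'a \<Rightarrow> real" and p :: nat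
  assumes "ergodic_automorphism M \<theta>"
    and "integrable M \<sigma>" and "integrable M \<tau>"
    and "\<And>\<omega>. \<omega> \<in> space M \<Longrightarrow> 0 \<le> \<sigma> \<omega>"
    and "\<And>\<omega>. \<omega> \<in> space M \<Longrightarrow> 0 \<le> \<tau> \<omega>"
    and "measure M {\<omega> \<in> space M. \<tau> \<omega> > 0} = 1"
    and "p \<ge> 1"
    and "GI_GI M \<theta> \<sigma> \<tau>"
    and "\<not> bounded (topological_support (distr M borel \<tau>))"
    and "measure M {\<omega> \<in> space M. Z M \<theta> \<sigma> \<tau> p \<omega> = 0} > 0"
  shows "\<exists>U. loss_solution M \<theta> \<sigma> \<tau> p U \<and>
           (\<forall>V. loss_solution M \<theta> \<sigma> \<tau> p V \<longrightarrow> (AE \<omega> in M. V \<omega> = U \<omega>)) \<and>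
           (AE \<omega> in M. \<forall>i<p. ereal (U \<omega> ! i) \<le> Z M \<theta> \<sigma> \<tau> (p - i) \<omega>)"
proof -
  interpret ergodic_automorphism M \<theta>
    by fact
  interpret loss_system M \<theta> \<sigma> \<tau> p
    using assms(2,3,5) by unfold_locales auto
  have tail: "0 < prob {\<omega> \<in> space M. c < \<tau> \<omega>}" for c
    using assms(5,9) by (intro prob_greater_of_unbounded_support measurable_tau)
  have visits: "AE \<omega> in M. \<exists>N. bound 1 ((\<theta>inv ^^ N) \<omega>) = 0"
    by (intro AE_visits_empty prob_bound_1_eq_0_pos[OF assms(8) tail assms(10)])
  show ?thesis
  proof (intro exI conjI allI impI)
    show "loss_solution M \<theta> \<sigma> \<tau> p stationary_workload"
      by (rule loss_solution_stationary_workload[OF visits])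
    show "AE \<omega> in M. V \<omega> = stationary_workload \<omega>" if "loss_solution M \<theta> \<sigma> \<tau> p V" for V
      by (rule loss_solution_unique[OF that tail visits])
    \<comment> \<open>At every point of \<open>space M\<close> the value is that of some system
      started empty, and all of these obey the bounds.\<close>
    show "AE \<omega> in M. \<forall>i<p. ereal (stationary_workload \<omega> ! i) \<le> bound (p - i) \<omega>"
      using AE_space
      by eventually_elim (simp add: stationary_workload_def workload_le_bound)
  qed
qed

end
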